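(* Let $T$ be the Takagi function, whose range on $[0,1]$ is $[0,\frac23]$, and for $y\in\mathbb{R}$ let $L(y)=\{x\in[0,1]:T(x)=y\}$. Then the set $$S_\infty^{loc,uc}:=\{y: L(y)\ \text{contains uncountably many distinct local level sets}\}$$ is residual in the range $[0,\frac23]$ of $T$.
   Context: The Takagi function is $T(x)=\sum_{n=0}^\infty \frac{1}{2^n}\phi(2^n x)$, where $\phi(x)=\operatorname{dist}(x,\mathbb{Z})$ is the distance from $x$ to the nearest integer. For $x\in[0,1)$ write the binary expansion $x=\sum_{n=1}^\infty \varepsilon_n/2^n$ with $\varepsilon_n\in\{0,1\}$, choosing the representation ending in all zeros if $x$ is a dyadic rational. For integers $k\ge 0$ put $D_k(x):=\sum_{j=1}^k(-1)^{\varepsilon_j}$. Define an equivalence relation on $[0,1)$ by $x\sim x'$ if and only if $|D_j(x)|=|D_j(x')|$ for every $j\in\mathbb{N}=\{1,2,\dots\}$. The local level set containing $x\in[0,1)$ is $L_x^{loc}:=\{x'\in[0,1): x'\sim x\}$. It is known that $x\sim x'$ implies $T(x)=T(x')$, so that each local level set is a subset of a level set $L(y)$. A subset of $[0,\frac23]$ is residual in $[0,\frac23]$ if its complement in $[0,\frac23]$ is meager (of first category) in $[0,\frac23]$. *)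

theory Defs
  imports "HOL-Analysis.Analysis"
begin

definition phi :: "real \<Rightarrow> real" where
  "phi x = infdist x \<int>"

definition takagi :: "real \<Rightarrow> real" where
  "takagi x = (\<Sum>n. phi (2 ^ n * x) / 2 ^ n)"

lemma phi_bounds: "0 \<le> phi x" "phi x \<le> 1"
proof -
  show "0 \<le> phi x" by (simp add: phi_def infdist_nonneg)
  have "infdist x \<int> \<le> dist x (of_int \<lfloor>x\<rfloor>)" by (rule infdist_le) auto
  also have "\<dots> \<le> 1" by (simp add: dist_real_def) linarith
  finally show "phi x \<le> 1" by (simp add: phi_def)
qed

lemma takagi_summable: "summable (\<lambda>n. phi (2 ^ n * x) / 2 ^ n)"
proof (rule summable_comparison_test)
  show "\<exists>N. \<forall>n\<ge>N. norm (phi (2 ^ n * x) / 2 ^ n) \<le> (1/2) ^ n"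
    using phi_bounds by (auto simp: power_divide divide_right_mono)
  show "summable (\<lambda>n. (1/2::real) ^ n)" by (rule summable_geometric) simp
qed

definition level_set :: "real \<Rightarrow> real set" where
  "level_set y = {x \<in> {0..1}. takagi x = y}"


definition dyadic_rational :: "real \<Rightarrow> bool" where
  "dyadic_rational x \<longleftrightarrow> (\<exists>(m::int) (k::nat). x = of_int m / 2 ^ k)"

text \<open>The digits are indexed from 1; \<open>e 0 = 0\<close> is a dummy that makes the digit
  function unique as a function on all of \<open>nat\<close>.\<close>

definition is_binary_expansion :: "real \<Rightarrow> (nat \<Rightarrow> nat) \<Rightarrow> bool" where
  "is_binary_expansion x e \<longleftrightarrow>
     e 0 = 0 \<and> (\<forall>n. e n \<in> {0, 1}) \<and>
     (\<lambda>n. real (e (Suc n)) / 2 ^ Suc n) sums x \<and>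
     (dyadic_rational x \<longrightarrow> (\<forall>\<^sub>F n in sequentially. e n = 0))"

definition binary_digit :: "real \<Rightarrow> nat \<Rightarrow> nat" where
  "binary_digit x = (THE e. is_binary_expansion x e)"

lemma is_binary_expansion_floor:
  assumes "is_binary_expansion x e" and "n \<ge> 1"
  shows "int (e n) = \<lfloor>2 ^ n * x\<rfloor> mod 2"
proof -
  have e01: "e k = 0 \<or> e k = 1" for k
    using assms(1) by (auto simp: is_binary_expansion_def)
  have sm: "(\<lambda>n. real (e (Suc n)) / 2 ^ Suc n) sums x"
    and dy: "dyadic_rational x \<Longrightarrow> \<forall>\<^sub>F n in sequentially. e n = 0"
    using assms(1) by (auto simp: is_binary_expansion_def)
  define P where "P k = (\<Sum>i<k. int (e (Suc i)) * 2 ^ (k - Suc i))" for k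
  have P_Suc: "P (Suc k) = 2 * P k + int (e (Suc k))" for k
  proof -
    have "(\<Sum>i<k. int (e (Suc i)) * 2 ^ (Suc k - Suc i)) = (\<Sum>i<k. 2 * (int (e (Suc i)) * 2 ^ (k - Suc i)))"
      by (rule sum.cong) (auto simp: Suc_diff_Suc simp flip: power_Suc)
    thus ?thesis by (simp add: P_def sum_distrib_left)
  qed
  have part: "2 ^ k * (\<Sum>i<k. real (e (Suc i)) / 2 ^ Suc i) = of_int (P k)" for k
  proof (induction k)
    case (Suc k)
    have "2 ^ Suc k * (\<Sum>i<Suc k. real (e (Suc i)) / 2 ^ Suc i)
       = 2 * (2 ^ k * (\<Sum>i<k. real (e (Suc i)) / 2 ^ Suc i)) + real (e (Suc k))"
      by (simp add: field_simps)
    with Suc show ?case by (simp add: P_Suc)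
  qed (simp add: P_def)
  define t where "t k = 2 ^ k * x - of_int (P k)" for k
  have tail: "(\<lambda>i. real (e (Suc (i + k))) / 2 ^ Suc i) sums t k" for k
  proof -
    have "(\<lambda>i. real (e (Suc (i + k))) / 2 ^ Suc (i + k)) sums
            (x - (\<Sum>i<k. real (e (Suc i)) / 2 ^ Suc i))"
      using sm by (subst sums_iff_shift) simp
    from sums_mult[OF this, of "2 ^ k"]
    have "(\<lambda>i. 2 ^ k * (real (e (Suc (i + k))) / 2 ^ Suc (i + k))) sums t k"
      by (simp only: right_diff_distrib part t_def)
    moreover have "2 ^ k * (real (e (Suc (i + k))) / 2 ^ Suc (i + k))
        = real (e (Suc (i + k))) / 2 ^ Suc i" for i
      by (simp add: power_add)
    ultimately show ?thesis by (simp only:)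
  qed
  have geo: "(\<lambda>i. 1 / 2 ^ Suc i :: real) sums 1"
    using power_half_series by (simp add: power_divide)
  have t0: "0 \<le> t k" for k
    by (rule sums_le[OF _ sums_zero tail]) simp
  have t1: "t k < 1" for k
  proof (rule ccontr)
    assume "\<not> t k < 1"
    have df: "(\<lambda>i. (1 - real (e (Suc (i + k)))) / 2 ^ Suc i) sums (1 - t k)"
      using sums_diff[OF geo tail[of k]] by (simp add: diff_divide_distrib)
    have nn: "0 \<le> (1 - real (e (Suc (i + k)))) / 2 ^ Suc i" for i
      using e01[of "Suc (i + k)"] by auto
    have "0 \<le> 1 - t k" by (rule sums_le[OF _ sums_zero df]) (rule nn)
    with \<open>\<not> t k < 1\<close> have tk: "t k = 1" by simp
    with df have z: "(\<lambda>i. (1 - real (e (Suc (i + k)))) / 2 ^ Suc i) sums 0" by simp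
    have "\<forall>i. (1 - real (e (Suc (i + k)))) / 2 ^ Suc i = 0"
      using suminf_eq_zero_iff[OF sums_summable[OF z] nn] sums_unique[OF z] by simp
    hence ones: "e (Suc (i + k)) = 1" for i by simp
    have "x = of_int (P k + 1) / 2 ^ k" using tk by (simp add: t_def field_simps)
    hence "dyadic_rational x" unfolding dyadic_rational_def by blast
    from dy[OF this] obtain N where "\<And>n. n \<ge> N \<Longrightarrow> e n = 0"
      unfolding eventually_sequentially by blast
    from this[of "Suc (N + k)"] ones[of N] show False by simp
  qed
  have fl: "\<lfloor>2 ^ k * x\<rfloor> = P k" for k
    using t0[of k] t1[of k] by (intro floor_unique) (auto simp: t_def)
  obtain k where k: "n = Suc k" using assms(2) by (cases n) auto
  show ?thesis using e01[of n] unfolding fl k P_Suc by auto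
qed

lemma ex1_binary_expansion:
  assumes "0 \<le> x" "x < 1"
  shows "\<exists>!e. is_binary_expansion x e"
proof (rule ex_ex1I)
  define e where "e n = (if n = 0 then 0 else nat (\<lfloor>2 ^ n * x\<rfloor> mod 2))" for n
  have rec: "\<lfloor>2 ^ Suc n * x\<rfloor> = 2 * \<lfloor>2 ^ n * x\<rfloor> + int (e (Suc n))" for n
  proof -
    have "\<lfloor>2 ^ Suc n * x\<rfloor> div 2 = \<lfloor>2 ^ Suc n * x / 2\<rfloor>"
      using floor_divide_real_eq_div[of 2 "2 ^ Suc n * x"] by simp
    hence "\<lfloor>2 ^ Suc n * x\<rfloor> div 2 = \<lfloor>2 ^ n * x\<rfloor>" by simp
    moreover have "int (e (Suc n)) = \<lfloor>2 ^ Suc n * x\<rfloor> mod 2" by (simp add: e_def)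
    ultimately show ?thesis by (metis mult_div_mod_eq)
  qed
  have part: "(\<Sum>i<n. real (e (Suc i)) / 2 ^ Suc i) = of_int \<lfloor>2 ^ n * x\<rfloor> / 2 ^ n" for n
  proof (induction n)
    case 0 show ?case using assms by (simp add: floor_eq_iff)
  next
    case (Suc n) show ?case
      using Suc rec[of n] by (simp del: power_Suc) (simp add: field_simps)
  qed
  have lim: "(\<lambda>n. of_int \<lfloor>2 ^ n * x\<rfloor> / 2 ^ n) \<longlonglongrightarrow> x"
  proof (rule tendsto_sandwich)
    show "\<forall>\<^sub>F n in sequentially. x - (1/2) ^ n \<le> of_int \<lfloor>2 ^ n * x\<rfloor> / 2 ^ n"
    proof (rule always_eventually, rule allI)
      fix n
      have "2 ^ n * x - 1 \<le> of_int \<lfloor>2 ^ n * x\<rfloor>" by linarith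
      thus "x - (1/2) ^ n \<le> of_int \<lfloor>2 ^ n * x\<rfloor> / 2 ^ n"
        using divide_right_mono[of "2 ^ n * x - 1" "of_int \<lfloor>2 ^ n * x\<rfloor>" "2 ^ n"]
        by (simp add: diff_divide_distrib power_divide)
    qed
    show "\<forall>\<^sub>F n in sequentially. of_int \<lfloor>2 ^ n * x\<rfloor> / 2 ^ n \<le> x"
    proof (rule always_eventually, rule allI)
      fix n
      have "of_int \<lfloor>2 ^ n * x\<rfloor> \<le> 2 ^ n * x" by linarith
      thus "of_int \<lfloor>2 ^ n * x\<rfloor> / 2 ^ n \<le> x" by (simp add: field_simps)
    qed
    have "(\<lambda>n. x - (1/2) ^ n) \<longlonglongrightarrow> x - 0"
      by (intro tendsto_intros LIMSEQ_realpow_zero) auto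
    thus "(\<lambda>n. x - (1/2) ^ n) \<longlonglongrightarrow> x" by simp
  qed simp
  have "\<forall>\<^sub>F n in sequentially. e n = 0" if dyad: "dyadic_rational x"
  proof -
    obtain m :: int and k where mk: "x = of_int m / 2 ^ k"
      using dyad unfolding dyadic_rational_def by blast
    have "e n = 0" if ge: "n \<ge> Suc k" for n
    proof -
      obtain j where j: "n = Suc k + j" using ge le_Suc_ex by blast
      have "2 ^ n * x = of_int (2 * (2 ^ j * m))"
        unfolding mk j by (simp add: power_add)
      hence "\<lfloor>2 ^ n * x\<rfloor> = 2 * (2 ^ j * m)" by (simp only: floor_of_int)
      thus ?thesis by (simp add: e_def)
    qed
    thus ?thesis unfolding eventually_sequentially by blast
  qed
  moreover have "e n \<in> {0, 1}" for n
    unfolding e_def by (auto simp: nat_eq_iff)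
  ultimately have "is_binary_expansion x e"
    unfolding is_binary_expansion_def sums_def part using lim by (auto simp: e_def)
  thus "\<exists>e. is_binary_expansion x e" by blast
next
  fix e e' assume a: "is_binary_expansion x e" "is_binary_expansion x e'"
  show "e = e'"
  proof
    fix n show "e n = e' n"
    proof (cases "n = 0")
      case True thus ?thesis using a by (simp add: is_binary_expansion_def)
    next
      case False
      hence "int (e n) = int (e' n)"
        using a[THEN is_binary_expansion_floor, of n] by simp
      thus ?thesis by simp
    qed
  qed
qed

lemma is_binary_expansion_binary_digit:
  assumes "0 \<le> x" "x < 1"
  shows "is_binary_expansion x (binary_digit x)"
  unfolding binary_digit_def by (rule theI'[OF ex1_binary_expansion[OF assms]])

lemma binary_digit_floor:
  assumes "0 \<le> x" "x < 1" "n \<ge> 1"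
  shows "int (binary_digit x n) = \<lfloor>2 ^ n * x\<rfloor> mod 2"
  using is_binary_expansion_floor[OF is_binary_expansion_binary_digit] assms by blast

definition D :: "nat \<Rightarrow> real \<Rightarrow> int" where
  "D k x = (\<Sum>j=1..k. (-1) ^ binary_digit x j)"

definition loc_equiv :: "real \<Rightarrow> real \<Rightarrow> bool" where
  "loc_equiv x x' \<longleftrightarrow> (\<forall>j\<ge>1. \<bar>D j x\<bar> = \<bar>D j x'\<bar>)"

definition local_level_set :: "real \<Rightarrow> real set" where
  "local_level_set x = {x' \<in> {0..<1}. loc_equiv x' x}"

definition S_inf_loc_uc :: "real set" where
  "S_inf_loc_uc =
     {y. uncountable {A. A \<subseteq> level_set y \<and> (\<exists>x\<in>{0..<1}. A = local_level_set x)}}"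


definition nowhere_dense_in :: "'a topology \<Rightarrow> 'a set \<Rightarrow> bool" where
  "nowhere_dense_in X A \<longleftrightarrow> A \<subseteq> topspace X \<and> X interior_of (X closure_of A) = {}"

definition meager_in :: "'a topology \<Rightarrow> 'a set \<Rightarrow> bool" where
  "meager_in X M \<longleftrightarrow> (\<exists>\<A>. countable \<A> \<and> (\<forall>A\<in>\<A>. nowhere_dense_in X A) \<and> M = \<Union>\<A>)"

definition residual_in :: "'a topology \<Rightarrow> 'a set \<Rightarrow> bool" where
  "residual_in X S \<longleftrightarrow> S \<subseteq> topspace X \<and> meager_in X (topspace X - S)"

end

theory Submission
  imports Defs "HOL-Real_Asymp.Real_Asymp"
begin

text \<open>If a word \<open>w\<close> of \<open>2m\<close> binary digits has as many zeros as ones, then the graph of \<open>T\<close>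
  above the dyadic interval of \<open>w\<close> is a copy of the whole graph, scaled by \<open>4\<^sup>-\<^sup>m\<close>
  (a hump). Humps are dense in the graph. The humps of the words 01 and 0011 have the overlapping
  ranges \<open>[1/2, 2/3]\<close> and \<open>[1/2, 13/24]\<close>, but the values \<open>\<bar>D\<^sub>2\<bar>\<close> on them are 0 and 2, so they
  share no local level set. For generic \<open>y\<close>, every hump whose range contains \<open>y\<close> therefore contains a
  smaller hump in which \<open>y\<close> lies in both of these subranges. Iterating yields a binary tree of humps whose
  \<open>2\<^sup>\<omega>\<close> branches are points of \<open>L(y)\<close> in pairwise distinct local level sets.\<close>

section \<open>Elementary properties of the Takagi function\<close>

lemma phi_eq_self:
  assumes "0 \<le> x" "x \<le> 1/2"
  shows "phi x = x"
proof (rule antisym)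
  show "phi x \<le> x"
    unfolding phi_def using infdist_le[of 0 \<int> x] assms by (simp add: dist_real_def)
  have "x \<le> dist x a" if "a \<in> \<int>" for a
  proof -
    obtain k :: int where k: "a = of_int k" using \<open>a \<in> \<int>\<close> by (rule Ints_cases)
    consider "k \<le> 0" | "k \<ge> 1" by linarith
    thus ?thesis using assms by cases (auto simp: k dist_real_def abs_if)
  qed
  thus "x \<le> phi x"
    unfolding phi_def by (subst infdist_def) (auto intro!: cINF_greatest)
qed

lemma phi_minus: "phi (- x) = phi x"
proof -
  have "phi (- x) \<le> phi x" for x
  proof -
    have "infdist (- x) \<int> \<le> dist x a" if "a \<in> \<int>" for a :: real
      using infdist_le[of "- a" \<int> "- x"] that by (simp add: dist_real_def abs_minus_commute)
    thus ?thesis unfolding phi_def by (subst (2) infdist_def) (auto intro!: cINF_greatest)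
  qed
  from this[of x] this[of "- x"] show ?thesis by simp
qed

lemma phi_add_int: "phi (x + of_int k) = phi x"
proof -
  have "phi (x + of_int k) \<le> phi x" for x k
  proof -
    have "infdist (x + of_int k) \<int> \<le> dist x a" if "a \<in> \<int>" for a :: real
      using infdist_le[of "a + of_int k" \<int> "x + of_int k"] that by (simp add: dist_real_def)
    thus ?thesis unfolding phi_def by (subst (2) infdist_def) (auto intro!: cINF_greatest)
  qed
  from this[of x k] this[of "x + of_int k" "- k"] show ?thesis by simp
qed

lemma phi_eq_one_minus:
  assumes "1/2 \<le> x" "x \<le> 1"
  shows "phi x = 1 - x"
  using phi_add_int[of "- x" 1] phi_minus[of x] phi_eq_self[of "1 - x"] assms by simp

lemma takagi_rec: "takagi x = phi x + takagi (2 * x) / 2"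
proof -
  have "takagi x = phi x + (\<Sum>n. phi (2 ^ Suc n * x) / 2 ^ Suc n)"
    unfolding takagi_def using suminf_split_head[OF takagi_summable[of x]] by simp
  also have "(\<lambda>n. phi (2 ^ Suc n * x) / 2 ^ Suc n) = (\<lambda>n. phi (2 ^ n * (2 * x)) / 2 ^ n / 2)"
    by (simp add: mult_ac)
  also have "suminf \<dots> = takagi (2 * x) / 2"
    unfolding takagi_def by (rule suminf_divide[OF takagi_summable])
  finally show ?thesis .
qed

lemma takagi_add_int: "takagi (x + of_int k) = takagi x"
proof -
  have "phi (2 ^ n * (x + of_int k)) = phi (2 ^ n * x)" for n
    using phi_add_int[of "2 ^ n * x" "2 ^ n * k"] by (simp add: algebra_simps)
  thus ?thesis by (simp add: takagi_def)
qed

text \<open>Prepending the digit \<open>a\<close>: \<open>phi\<close> is linear on each half of the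
  unit interval, and periodicity removes \<open>a\<close> from the remaining series.\<close>

lemma takagi_half:
  assumes "0 \<le> t" "t \<le> 1"
  shows "takagi ((of_bool a + t) / 2) = (if a then 1 - t else t) / 2 + takagi t / 2"
proof -
  have "2 * ((of_bool a + t) / 2) = of_bool a + t" by simp
  hence "takagi ((of_bool a + t) / 2) = phi ((of_bool a + t) / 2) + takagi (of_bool a + t) / 2"
    using takagi_rec[of "(of_bool a + t) / 2"] by (simp only:)
  moreover have "takagi (of_bool a + t) = takagi t"
    using takagi_add_int[of t 1] by (cases a) (simp_all add: add.commute)
  moreover have "phi ((of_bool a + t) / 2) = (if a then 1 - t else t) / 2"
    using phi_eq_self[of "t / 2"] phi_eq_one_minus[of "(1 + t) / 2"] assms
    by (cases a) (simp_all add: field_simps)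
  ultimately show ?thesis by simp
qed

lemma takagi_0: "takagi 0 = 0"
  using takagi_half[of 0 False] by simp

lemma takagi_one_half: "takagi (1/2) = 1/2"
  using takagi_half[of 0 True] takagi_0 by simp

lemma takagi_quarters: "takagi (1/4) = 1/2" "takagi (3/4) = 1/2"
  using takagi_half[of "1/2" False] takagi_half[of "1/2" True] takagi_one_half by simp_all

text \<open>Doubling modulo 1 swaps 1/3 and 2/3, so their values solve two linear equations.\<close>

lemma takagi_one_third: "takagi (1/3) = 2/3"
proof -
  have "takagi (1/3) = 1/3 + takagi (2/3) / 2" using takagi_half[of "2/3" False] by simp
  moreover have "takagi (2/3) = 1/3 + takagi (1/3) / 2" using takagi_half[of "1/3" True] by simp
  ultimately show ?thesis by linarith
qed

lemma takagi_nonneg: "0 \<le> takagi x"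
  unfolding takagi_def by (rule suminf_nonneg[OF takagi_summable]) (simp add: phi_bounds)

lemma takagi_le_2: "takagi x \<le> 2"
proof -
  have "takagi x \<le> (\<Sum>n. (1/2) ^ n)"
    unfolding takagi_def
    by (rule suminf_le[OF _ takagi_summable summable_geometric])
      (auto simp: power_divide divide_right_mono phi_bounds)
  thus ?thesis by (simp add: suminf_geometric)
qed

text \<open>The first two terms of the series sum to a trapezoid of height 1/2.\<close>

lemma takagi_le_quarter: "takagi x \<le> 1/2 + takagi (4 * x) / 4"
proof -
  have "takagi y \<le> 1/2 + takagi (4 * y) / 4" if "0 \<le> y" "y < 1" for y
  proof -
    have "phi y + phi (2 * y) / 2 \<le> 1/2"
    proof (cases "y \<le> 1/2")
      case True
      thus ?thesis
        using that phi_eq_self[of y] phi_eq_self[of "2 * y"] phi_eq_one_minus[of "2 * y"]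
        by (cases "y \<le> 1/4") (simp_all add: field_simps)
    next
      case False
      hence "phi (2 * y) = phi (2 * y - 1)" using phi_add_int[of "2 * y" "-1"] by simp
      thus ?thesis
        using that False phi_eq_one_minus[of y] phi_eq_self[of "2 * y - 1"]
          phi_eq_one_minus[of "2 * y - 1"]
        by (cases "y \<le> 3/4") (simp_all add: field_simps)
    qed
    thus ?thesis using takagi_rec[of y] takagi_rec[of "2 * y"] by (simp add: field_simps)
  qed
  from this[of "frac x"] have "takagi (frac x) \<le> 1/2 + takagi (4 * frac x) / 4"
    by (simp add: frac_lt_1)
  thus ?thesis
    using takagi_add_int[of x "- \<lfloor>x\<rfloor>"] takagi_add_int[of "4 * x" "- 4 * \<lfloor>x\<rfloor>"]
    by (simp add: frac_def)
qed

lemma takagi_le: "takagi x \<le> 2/3"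
proof -
  \<comment> \<open>The crude bound 2 is contracted towards 2/3, the fixed point of s -> 1/2 +
    s/4.\<close>
  have *: "takagi x \<le> 2/3 + 2 / 4 ^ n" for n x
  proof (induction n arbitrary: x)
    case 0 show ?case using takagi_le_2[of x] by simp
  next
    case (Suc n) show ?case using takagi_le_quarter[of x] Suc[of "4 * x"] by simp
  qed
  have "(\<lambda>n. 2/3 + 2 / 4 ^ n :: real) \<longlonglongrightarrow> 2/3" by real_asymp
  thus ?thesis by (rule LIMSEQ_le_const) (use * in blast)
qed

lemma continuous_takagi: "continuous_on A takagi"
proof -
  have "uniform_limit A (\<lambda>N x. \<Sum>n<N. phi (2 ^ n * x) / 2 ^ n) takagi sequentially"
    unfolding takagi_def
    by (rule Weierstrass_m_test[where M = "\<lambda>n. (1/2) ^ n"])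
      (simp_all add: power_divide divide_right_mono phi_bounds, simp flip: power_one_over)
  moreover have "continuous_on A (\<lambda>x. \<Sum>n<N. phi (2 ^ n * x) / 2 ^ n)" for N
    unfolding phi_def by (intro continuous_intros) auto
  ultimately show ?thesis by (intro uniform_limit_theorem) auto
qed

lemma takagi_image: "takagi ` {0..1} = {0..2/3}"
proof
  show "takagi ` {0..1} \<subseteq> {0..2/3}" using takagi_nonneg takagi_le by auto
  show "{0..2/3} \<subseteq> takagi ` {0..1}"
  proof
    fix y :: real assume "y \<in> {0..2/3}"
    then obtain x where "0 \<le> x" "x \<le> 1/3" "takagi x = y"
      using IVT'[of takagi 0 y "1/3"] continuous_takagi takagi_0 takagi_one_third by auto
    thus "y \<in> takagi ` {0..1}" by (intro image_eqI[of _ _ x]) auto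
  qed
qed

section \<open>Binary words\<close>

text \<open>The dyadic interval of the word \<open>w\<close> is \<open>pt w ` {0..1}\<close>, and \<open>balance w\<close> is the value of
  \<open>D (length w)\<close> on it (right endpoint excluded). \<open>True\<close> stands for the digit 1.\<close>

primrec pt :: "bool list \<Rightarrow> real \<Rightarrow> real" where
  "pt [] t = t"
| "pt (a # w) t = (of_bool a + pt w t) / 2"

primrec balance :: "bool list \<Rightarrow> int" where
  "balance [] = 0"
| "balance (a # w) = (if a then -1 else 1) + balance w"

lemma pt_append: "pt (u @ v) t = pt u (pt v t)"
  by (induction u) auto

lemma balance_append: "balance (u @ v) = balance u + balance v"
  by (induction u) auto

lemma balance_replicate: "balance (replicate n a) = (if a then - int n else int n)"
  by (induction n) auto

lemma abs_balance_le: "\<bar>balance w\<bar> \<le> int (length w)"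
  by (induction w) auto

lemma pt_affine: "pt w t = pt w 0 + t / 2 ^ length w"
  by (induction w) (auto simp: field_simps)

lemma pt_bounds: "0 \<le> t \<Longrightarrow> t \<le> 1 \<Longrightarrow> 0 \<le> pt w t \<and> pt w t \<le> 1"
  by (induction w) auto

text \<open>One digit 0 keeps the interval of \<open>w\<close> away from 1, even at
  \<open>t = 1\<close>. This later excludes right endpoints of dyadic intervals.\<close>

lemma pt_less_1: "0 \<le> t \<Longrightarrow> t \<le> 1 \<Longrightarrow> t < 1 \<or> False \<in> set w \<Longrightarrow> pt w t < 1"
proof (induction w)
  case (Cons a w) thus ?case using pt_bounds[of t w] by (cases a) auto
qed auto

text \<open>Scaling by \<open>2 ^ length w\<close> is, modulo 1, the shift that deletes
  \<open>w\<close>.\<close>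

lemma scaled_pt_cong_int: "\<exists>k::int. 2 ^ length w * pt w t = of_int k + t"
proof (induction w)
  case Nil show ?case by (intro exI[of _ 0]) simp
next
  case (Cons a w)
  then obtain k :: int where "2 ^ length w * pt w t = of_int k + t" by blast
  thus ?case
    by (intro exI[of _ "of_bool a * 2 ^ length w + k"]) (cases a; simp add: algebra_simps)
qed

text \<open>The digit is the parity of a floor. Here \<open>t < 1\<close> matters: at a right
  endpoint the canonical expansion may have other digits.\<close>

lemma binary_digit_pt:
  assumes "0 \<le> t" "t < 1"
  shows "binary_digit (pt (u @ a # v) t) (Suc (length u)) = of_bool a"
proof -
  define s where "s = pt v t"
  define x where "x = pt (u @ a # v) t"
  have s: "0 \<le> s" "s < 1" using pt_bounds[of t v] pt_less_1[of t v] assms by (auto simp: s_def)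
  have x: "0 \<le> x" "x < 1"
    using pt_bounds[of t "u @ a # v"] pt_less_1[of t "u @ a # v"] assms by (auto simp: x_def)
  obtain k :: int where "2 ^ length u * pt u ((of_bool a + s) / 2) = of_int k + (of_bool a + s) / 2"
    using scaled_pt_cong_int by blast
  hence "2 ^ Suc (length u) * x = of_int (2 * k + of_bool a) + s"
    by (simp add: x_def s_def pt_append algebra_simps)
  hence "\<lfloor>2 ^ Suc (length u) * x\<rfloor> = 2 * k + of_bool a"
    using s by (intro floor_unique) auto
  with binary_digit_floor[OF x, of "Suc (length u)"] show ?thesis by (cases a) (auto simp: x_def)
qed

lemma D_pt:
  assumes "0 \<le> t" "t < 1"
  shows "D (length w) (pt (w @ v) t) = balance w"
proof (induction w arbitrary: v rule: rev_induct)
  case Nil show ?case by (simp add: D_def)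
next
  case (snoc a w)
  have "D (Suc (length w)) (pt (w @ a # v) t) =
      D (length w) (pt (w @ a # v) t) + (-1) ^ binary_digit (pt (w @ a # v) t) (Suc (length w))"
    by (simp add: D_def)
  thus ?case using snoc[of "a # v"] binary_digit_pt[OF assms, of w a v]
    by (simp add: balance_append)
qed

lemma ex_pt:
  assumes "0 \<le> x" "x \<le> 1"
  shows "\<exists>w t. length w = n \<and> x = pt w t \<and> 0 \<le> t \<and> t \<le> 1 \<and> (x < 1 \<longrightarrow> t < 1)"
proof (induction n)
  case 0 thus ?case using assms by (intro exI[of _ "[]"] exI[of _ x]) simp
next
  case (Suc n)
  then obtain w t where w: "length w = n" "x = pt w t" "0 \<le> t" "t \<le> 1" "x < 1 \<longrightarrow> t < 1" by blast
  \<comment> \<open>A tie goes to the digit 1, so the new parameter stays below 1 whenever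
    \<open>t\<close> does.\<close>
  define a where "a = (t \<ge> 1/2)"
  show ?case
    using w by (intro exI[of _ "w @ [a]"] exI[of _ "2 * t - of_bool a"])
      (auto simp: pt_append a_def)
qed

text \<open>On the interval of \<open>w\<close> the first \<open>length w\<close> terms of the
  series form an affine function of slope \<open>balance w\<close>; the others form a scaled copy of
  T.\<close>

lemma takagi_pt:
  assumes "0 \<le> t" "t \<le> 1"
  shows "takagi (pt w t) = takagi (pt w 0) + (of_int (balance w) * t + takagi t) / 2 ^ length w"
proof (induction w)
  case Nil show ?case by (simp add: takagi_0)
next
  case (Cons a w)
  have half: "takagi (pt (a # w) s) = (if a then 1 - pt w s else pt w s) / 2 + takagi (pt w s) / 2"
    if "0 \<le> s" "s \<le> 1" for s
    using takagi_half[of "pt w s" a] pt_bounds[OF that, of w] by simp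
  have "takagi (pt (a # w) t) - takagi (pt (a # w) 0) =
      ((takagi (pt w t) - takagi (pt w 0)) + (if a then -1 else 1) * (pt w t - pt w 0)) / 2"
    unfolding half[OF assms] half[OF order.refl zero_le_one] by (cases a) (simp_all add: field_simps)
  also have "takagi (pt w t) - takagi (pt w 0) = (of_int (balance w) * t + takagi t) / 2 ^ length w"
    using Cons by simp
  also have "pt w t - pt w 0 = t / 2 ^ length w"
    using pt_affine[of w t] by simp
  also have "((of_int (balance w) * t + takagi t) / 2 ^ length w +
        (if a then -1 else 1) * (t / 2 ^ length w)) / 2 =
      (of_int (balance (a # w)) * t + takagi t) / 2 ^ length (a # w)"
    by (simp add: field_simps)
  finally show ?case by simp
qed

text \<open>The slope is at most \<open>length w\<close> in absolute value and T oscillates by less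
  than 1.\<close>

lemma takagi_pt_dist:
  assumes "0 \<le> t" "t \<le> 1" "0 \<le> t'" "t' \<le> 1"
  shows "\<bar>takagi (pt w t) - takagi (pt w t')\<bar> \<le> (real (length w) + 1) / 2 ^ length w"
proof -
  have "\<bar>of_int (balance w) * (t - t')\<bar> \<le> real (length w) * 1"
    unfolding abs_mult
  proof (rule mult_mono)
    show "\<bar>real_of_int (balance w)\<bar> \<le> real (length w)" using abs_balance_le[of w] by linarith
  qed (use assms in auto)
  moreover have "\<bar>takagi t - takagi t'\<bar> \<le> 1"
    using takagi_nonneg[of t] takagi_nonneg[of t'] takagi_le[of t] takagi_le[of t'] by linarith
  ultimately have "\<bar>of_int (balance w) * (t - t') + (takagi t - takagi t')\<bar> \<le> real (length w) + 1"
    by linarith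
  moreover have "takagi (pt w t) - takagi (pt w t') =
      (of_int (balance w) * (t - t') + (takagi t - takagi t')) / 2 ^ length w"
    using takagi_pt[OF assms(1,2), of w] takagi_pt[OF assms(3,4), of w] by (simp add: field_simps)
  ultimately show ?thesis by (simp add: divide_right_mono)
qed

section \<open>Local level sets\<close>

text \<open>Appending a digit \<open>a\<close> with sign \<open>\<sigma>\<close> changes the value of \<open>T\<close> at the midpoint by
  \<open>- \<sigma> D\<^sub>n / 2\<^bsup>n+2\<^esup>\<close>, and \<open>2 \<sigma> D\<^sub>n = D\<^bsub>n+1\<^esub>\<^sup>2 - D\<^sub>n\<^sup>2 - 1\<close> depends on the absolute values only.\<close>

lemma takagi_pt_half_cong:
  assumes "length w = length w'"
    and "\<And>k. k \<le> length w \<Longrightarrow> \<bar>balance (take k w)\<bar> = \<bar>balance (take k w')\<bar>"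
  shows "takagi (pt w (1/2)) = takagi (pt w' (1/2))"
  using assms
proof (induction w arbitrary: w' rule: rev_induct)
  case (snoc a w)
  then obtain u b where w': "w' = u @ [b]" "length u = length w"
    by (cases w' rule: rev_cases) auto
  have IH: "takagi (pt w (1/2)) = takagi (pt u (1/2))"
  proof (rule snoc.IH)
    fix k assume "k \<le> length w"
    thus "\<bar>balance (take k w)\<bar> = \<bar>balance (take k u)\<bar>" using snoc.prems(2)[of k] w' by simp
  qed (use w' in simp)
  \<comment> \<open>The new midpoint has parameter 1/4 or 3/4 in the interval of \<open>w\<close>,
    where T is 1/2 just as at the old one; only the linear term changes.\<close>
  have step: "takagi (pt (w @ [a]) (1/2)) = takagi (pt w (1/2)) -
      (of_int ((balance (w @ [a]))\<^sup>2 - (balance w)\<^sup>2) - 1) / (8 * 2 ^ length w)" for w a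
    using takagi_pt[of "1/2" w] takagi_pt[of "1/4" w] takagi_pt[of "3/4" w]
      takagi_quarters takagi_one_half
    by (cases a) (simp_all add: pt_append balance_append field_simps power2_eq_square)
  have "\<bar>balance w\<bar> = \<bar>balance u\<bar>" "\<bar>balance (w @ [a])\<bar> = \<bar>balance (u @ [b])\<bar>"
    using snoc.prems(2)[of "length w"] snoc.prems(2)[of "Suc (length w)"] w' by auto
  hence "(balance w)\<^sup>2 = (balance u)\<^sup>2" "(balance (w @ [a]))\<^sup>2 = (balance (u @ [b]))\<^sup>2"
    by (metis power2_abs)+
  thus ?case using step[of w a] step[of u b] IH w' by simp
qed auto

text \<open>At every depth the dyadic intervals of the two points have equal midpoint values, and T
  varies little over each. This puts a whole local level set into one level set.\<close>

lemma loc_equiv_imp_takagi_eq: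
  assumes "x \<in> {0..<1}" "x' \<in> {0..<1}" "loc_equiv x x'"
  shows "takagi x = takagi x'"
proof -
  have bd: "\<bar>takagi x - takagi x'\<bar> \<le> 2 * ((real n + 1) / 2 ^ n)" for n
  proof -
    obtain w t where w: "length w = n" "x = pt w t" "0 \<le> t" "t < 1"
      using ex_pt[of x n] assms(1) by auto
    obtain w' t' where w': "length w' = n" "x' = pt w' t'" "0 \<le> t'" "t' < 1"
      using ex_pt[of x' n] assms(2) by auto
    have "takagi (pt w (1/2)) = takagi (pt w' (1/2))"
    proof (rule takagi_pt_half_cong)
      fix k assume k: "k \<le> length w"
      have "D k x = balance (take k w)" "D k x' = balance (take k w')"
        using D_pt[of t "take k w" "drop k w"] D_pt[of t' "take k w'" "drop k w'"] k w w' by simp_all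
      thus "\<bar>balance (take k w)\<bar> = \<bar>balance (take k w')\<bar>"
        using assms(3)[unfolded loc_equiv_def, rule_format, of k] by (cases "k = 0") auto
    qed (use w w' in simp)
    moreover have "\<bar>takagi x - takagi (pt w (1/2))\<bar> \<le> (real n + 1) / 2 ^ n"
      using takagi_pt_dist[of t "1/2" w] w by simp
    moreover have "\<bar>takagi x' - takagi (pt w' (1/2))\<bar> \<le> (real n + 1) / 2 ^ n"
      using takagi_pt_dist[of t' "1/2" w'] w' by simp
    ultimately show ?thesis by linarith
  qed
  have "(\<lambda>n. 2 * ((real n + 1) / 2 ^ n)) \<longlonglongrightarrow> 0" by real_asymp
  hence "\<bar>takagi x - takagi x'\<bar> \<le> 0" by (rule LIMSEQ_le_const) (use bd in blast)
  thus ?thesis by simp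
qed

section \<open>Humps\<close>

text \<open>The value axis seen from inside the dyadic interval of a balanced word.\<close>

definition hump :: "bool list \<Rightarrow> real \<Rightarrow> real" where
  "hump w s = takagi (pt w 0) + s / 2 ^ length w"

lemma hump_takagi: "balance w = 0 \<Longrightarrow> 0 \<le> t \<Longrightarrow> t \<le> 1 \<Longrightarrow> takagi (pt w t) = hump w (takagi t)"
  by (simp add: hump_def takagi_pt[of t w])

lemma hump_append: "balance u = 0 \<Longrightarrow> hump (u @ v) s = hump u (hump v s)"
  using hump_takagi[of u "pt v 0"] pt_bounds[of 0 v]
  by (simp add: hump_def pt_append power_add add_divide_distrib mult.commute)

lemma dist_hump: "\<bar>hump w s - hump w s'\<bar> = \<bar>s - s'\<bar> / 2 ^ length w"
  by (simp add: hump_def flip: diff_divide_distrib)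

lemma hump_image: "hump w ` {a<..<b} = {hump w a<..<hump w b}"
    "hump w ` {a..b} = {hump w a..hump w b}"
proof -
  have vimage: "hump w ` S = {y. (y - takagi (pt w 0)) * 2 ^ length w \<in> S}" for S
    by (force simp: hump_def image_iff)
  show "hump w ` {a<..<b} = {hump w a<..<hump w b}"
    unfolding vimage by (auto simp: hump_def field_simps)
  show "hump w ` {a..b} = {hump w a..hump w b}"
    unfolding vimage by (auto simp: hump_def field_simps)
qed

text \<open>Each such \<open>s\<close> is a value of T, so \<open>hump w s\<close> is one
  too.\<close>

lemma hump_bounds:
  assumes "balance w = 0" "s \<in> {0..2/3}"
  shows "hump w s \<in> {0..2/3}"
proof -
  obtain t where "t \<in> {0..1}" "s = takagi t" using takagi_image assms(2) by blast
  thus ?thesis using hump_takagi[OF assms(1), of t] takagi_nonneg[of "pt w t"] takagi_le[of "pt w t"] by auto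
qed

text \<open>Take x with T(x) = y and pad its first n digits \<open>w\<close> to a balanced word. The
  resulting hump lies above a part of the interval of \<open>w\<close>, where T is close to
  y.\<close>

lemma humps_dense:
  assumes "y \<in> {0..2/3}" "\<epsilon> > 0"
  shows "\<exists>v. balance v = 0 \<and> (\<forall>s\<in>{0..2/3}. \<bar>hump v s - y\<bar> < \<epsilon>)"
proof -
  have "(\<lambda>n. (real n + 1) / 2 ^ n) \<longlonglongrightarrow> 0" by real_asymp
  hence "\<forall>\<^sub>F n in sequentially. (real n + 1) / 2 ^ n < \<epsilon>"
    using assms(2) by (rule order_tendstoD(2))
  then obtain n where n: "(real n + 1) / 2 ^ n < \<epsilon>"
    unfolding eventually_sequentially by blast
  have "y \<in> takagi ` {0..1}" using assms(1) by (simp only: takagi_image)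
  then obtain x where x: "0 \<le> x" "x \<le> 1" "y = takagi x" by auto
  obtain w t where w: "length w = n" "x = pt w t" "0 \<le> t" "t \<le> 1" using ex_pt[OF x(1,2)] by blast
  \<comment> \<open>As many copies of the rarer digit as are missing.\<close>
  define u where "u = replicate (nat \<bar>balance w\<bar>) (balance w > 0)"
  have bal: "balance (w @ u) = 0" by (simp add: balance_append u_def balance_replicate)
  have "\<bar>hump (w @ u) s - y\<bar> < \<epsilon>" if "s \<in> {0..2/3}" for s
  proof -
    obtain r where r: "r \<in> {0..1}" "s = takagi r" using takagi_image \<open>s \<in> {0..2/3}\<close> by blast
    hence "hump (w @ u) s = takagi (pt w (pt u r))"
      using hump_takagi[OF bal, of r] by (simp add: pt_append)
    moreover have "0 \<le> pt u r \<and> pt u r \<le> 1" using r by (intro pt_bounds) auto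
    ultimately show ?thesis using takagi_pt_dist[of "pt u r" t w] w x n by auto
  qed
  with bal show ?thesis by blast
qed

lemma hump_0_1: "hump [False, True] s = 1/2 + s / 4"
  and hump_0_0_1_1: "hump [False, False, True, True] s = 1/2 + s / 16"
proof -
  show "hump [False, True] s = 1/2 + s / 4" using takagi_quarters by (simp add: hump_def)
  \<comment> \<open>The interval of 0011 starts at 3/16, reached by halving 3/4 twice.\<close>
  show "hump [False, False, True, True] s = 1/2 + s / 16"
    using takagi_half[of "3/8" False] takagi_half[of "3/4" False] takagi_quarters
    by (simp add: hump_def)
qed

text \<open>The values in the range of the hump that no smaller hump brings into the overlap of the
  two fork ranges. The overlap is taken open to make this set closed.\<close>

definition bad :: "bool list \<Rightarrow> real set" where
  "bad w = hump w ` {0..2/3} - (\<Union>v\<in>{v. balance v = 0}. hump (w @ v) ` {1/2<..<13/24})"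

text \<open>The set is closed, and by density of humps the removed open sets come arbitrarily close
  to each of its points.\<close>

lemma nowhere_dense_bad:
  assumes w: "balance w = 0"
  shows "nowhere_dense_in (top_of_set {0..2/3}) (bad w \<inter> C)"
proof -
  let ?X = "top_of_set {0..2/3::real}"
  have sub: "bad w \<subseteq> {0..2/3}" using hump_bounds[OF w] by (auto simp: bad_def)
  have "closed (bad w)"
    unfolding bad_def hump_image by (intro closed_Diff open_UN ballI closed_atLeastAtMost open_greaterThanLessThan)
  hence "closedin ?X (bad w)" using sub closed_subset by blast
  hence cl: "?X closure_of (bad w \<inter> C) \<subseteq> bad w" by (intro closure_of_minimal) auto
  define U where "U = ?X interior_of (bad w)"
  have U: "openin ?X U" "U \<subseteq> bad w" by (simp_all add: U_def interior_of_subset)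
  have "U = {}"
  proof (rule ccontr)
    assume "U \<noteq> {}"
    then obtain y where y: "y \<in> U" by blast
    obtain V where V: "open V" "U = {0..2/3} \<inter> V"
      using U(1) unfolding openin_open by blast
    obtain s where s: "s \<in> {0..2/3}" "y = hump w s" using y U(2) unfolding bad_def by blast
    obtain \<epsilon> where \<epsilon>: "\<epsilon> > 0" "\<And>z. dist z y < \<epsilon> \<Longrightarrow> z \<in> V"
      using V y unfolding open_dist by blast
    obtain v where v: "balance v = 0" "\<And>s'. s' \<in> {0..2/3} \<Longrightarrow> \<bar>hump v s' - s\<bar> < \<epsilon>"
      using humps_dense[OF s(1) \<epsilon>(1)] by blast
    \<comment> \<open>25/48 is the midpoint of the interval from 1/2 to 13/24.\<close>
    define z where "z = hump (w @ v) (25/48)"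
    have "\<bar>z - y\<bar> = \<bar>hump v (25/48) - s\<bar> / 2 ^ length w"
      unfolding z_def s(2) hump_append[OF w] by (rule dist_hump)
    also have "\<dots> \<le> \<bar>hump v (25/48) - s\<bar>"
      using divide_left_mono[of 1 "2 ^ length w" "\<bar>hump v (25/48) - s\<bar>"] by simp
    also have "\<dots> < \<epsilon>" by (rule v) simp
    finally have "z \<in> V" using \<epsilon>(2) by (simp add: dist_real_def)
    moreover have "z \<in> {0..2/3}"
      unfolding z_def by (rule hump_bounds) (use w v in \<open>auto simp: balance_append\<close>)
    ultimately have "z \<in> bad w" using V U(2) by blast
    moreover have "z \<in> hump (w @ v) ` {1/2<..<13/24}" by (auto simp: z_def)
    ultimately show False using v(1) by (auto simp: bad_def)
  qed
  thus ?thesis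
    using interior_of_mono[OF cl] sub by (auto simp: nowhere_dense_in_def U_def)
qed

section \<open>The tree of humps\<close>

lemma uncountable_nat_bool: "uncountable (UNIV :: (nat \<Rightarrow> bool) set)"
proof
  assume "countable (UNIV :: (nat \<Rightarrow> bool) set)"
  then obtain f :: "nat \<Rightarrow> nat \<Rightarrow> bool" where "range f = UNIV"
    using uncountable_def by blast
  \<comment> \<open>Cantor's diagonal sequence.\<close>
  then obtain n where "f n = (\<lambda>k. \<not> f k k)" by (metis UNIV_I imageE)
  thus False by metis
qed

text \<open>Both words are balanced and contain a 0; after two digits their digit sums are 0 and
  2.\<close>

abbreviation fork :: "bool \<Rightarrow> bool list" where
  "fork c \<equiv> if c then [False, True] else [False, False, True, True]"

text \<open>\<open>V\<close> is meant to lead from a hump to a smaller one that has y in both fork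
  ranges; \<open>b\<close> chooses the fork at each level.\<close>

primrec branch :: "(bool list \<Rightarrow> bool list) \<Rightarrow> (nat \<Rightarrow> bool) \<Rightarrow> nat \<Rightarrow> bool list" where
  "branch V b 0 = []"
| "branch V b (Suc n) = branch V b n @ V (branch V b n) @ fork (b n)"

lemma length_branch: "n \<le> length (branch V b n)"
  by (induction n) auto

lemma branch_cong: "(\<And>k. k < n \<Longrightarrow> b k = b' k) \<Longrightarrow> branch V b n = branch V b' n"
  by (induction n) auto

lemma branch_point:
  obtains x where "\<And>n. \<exists>t. 0 \<le> t \<and> t < 1 \<and> x = pt (branch V b n) t"
proof -
  define w where "w = branch V b"
  define J where "J n = pt (w n) ` {0..1}" for n
  have "(\<Inter>n\<in>UNIV. J n) \<noteq> {}"
  proof (rule compact_nest)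
    fix n
    have "continuous_on {0..1} (\<lambda>t. pt (w n) 0 + t / 2 ^ length (w n))"
      by (intro continuous_intros) auto
    hence "continuous_on {0..1} (pt (w n))" by (simp only: pt_affine[symmetric])
    thus "compact (J n)" unfolding J_def by (rule compact_continuous_image) simp
    show "J n \<noteq> {}" by (simp add: J_def)
  next
    have "J (Suc n) \<subseteq> J n" for n
    proof
      fix x assume "x \<in> J (Suc n)"
      then obtain t where t: "t \<in> {0..1}" "x = pt (w n) (pt (V (w n) @ fork (b n)) t)"
        by (auto simp: J_def w_def pt_append simp del: append_assoc)
      thus "x \<in> J n" unfolding J_def
        using pt_bounds[of t "V (w n) @ fork (b n)"] by auto
    qed
    thus "J n \<subseteq> J m" if "m \<le> n" for m n using that by (rule lift_Suc_antimono_le)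
  qed
  then obtain x where x: "x \<in> J n" for n by blast
  have x_pt: "\<exists>t. 0 \<le> t \<and> t < 1 \<and> x = pt (w n) t" for n
  proof -
    \<comment> \<open>One level deeper the fork contributes a digit 0, so the parameter at level
      \<open>n\<close> is below 1 even if \<open>t = 1\<close>.\<close>
    obtain t where t: "0 \<le> t" "t \<le> 1" "x = pt (w n @ V (w n) @ fork (b n)) t"
      using x[of "Suc n"] by (auto simp: J_def w_def)
    have "0 \<le> pt (V (w n) @ fork (b n)) t" "pt (V (w n) @ fork (b n)) t < 1"
      using pt_bounds[OF t(1,2)] pt_less_1[OF t(1,2), of "V (w n) @ fork (b n)"] by auto
    thus ?thesis using t(3) pt_append[of "w n"] by blast
  qed
  show ?thesis using x_pt unfolding w_def by (rule that)
qed

text \<open>At the first \<open>n\<close> where \<open>b\<close> and \<open>b'\<close> differ, both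
  branches share the balanced word in front of the fork. Two digits into the fork \<open>D\<close>
  is 0 on one branch and 2 on the other.\<close>

lemma branch_not_loc_equiv:
  assumes bal: "\<And>b n. balance (branch V b n @ V (branch V b n)) = 0"
    and x: "\<And>n. \<exists>t. 0 \<le> t \<and> t < 1 \<and> x = pt (branch V b n) t"
    and x': "\<And>n. \<exists>t. 0 \<le> t \<and> t < 1 \<and> x' = pt (branch V b' n) t"
    and "b \<noteq> b'"
  shows "\<not> loc_equiv x x'"
proof -
  define n where "n = (LEAST n. b n \<noteq> b' n)"
  have "\<exists>n. b n \<noteq> b' n" using \<open>b \<noteq> b'\<close> by auto
  hence bn: "b n \<noteq> b' n" unfolding n_def by (rule LeastI_ex)
  have "b k = b' k" if "k < n" for k using not_less_Least[OF that[unfolded n_def]] by blast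
  hence eq: "branch V b n = branch V b' n" by (rule branch_cong)
  define u where "u = branch V b n @ V (branch V b n)"
  have u: "balance u = 0" unfolding u_def by (rule bal)
  have D2: "D (length u + 2) z = (if c then 0 else 2)"
    if z: "\<exists>t. 0 \<le> t \<and> t < 1 \<and> z = pt (u @ fork c) t" for z c
  proof -
    obtain t where "0 \<le> t" "t < 1" "z = pt (u @ fork c) t" using z by blast
    thus ?thesis
      using D_pt[of t "u @ [False, True]" "[]"] D_pt[of t "u @ [False, False]" "[True, True]"] u
      by (cases c) (simp_all add: balance_append)
  qed
  have "D (length u + 2) x = (if b n then 0 else 2)"
    by (rule D2) (use x[of "Suc n"] in \<open>simp add: u_def\<close>)
  moreover have "D (length u + 2) x' = (if b' n then 0 else 2)"
    by (rule D2) (use x'[of "Suc n"] in \<open>simp add: u_def eq\<close>)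
  ultimately have "\<bar>D (length u + 2) x\<bar> \<noteq> \<bar>D (length u + 2) x'\<bar>" using bn by auto
  thus ?thesis by (auto simp: loc_equiv_def)
qed

lemma uncountably_many_local_level_sets:
  assumes y: "y \<in> {0..2/3}" and good: "\<And>w. balance w = 0 \<Longrightarrow> y \<notin> bad w"
  shows "y \<in> S_inf_loc_uc"
proof -
  have "\<exists>v. balance v = 0 \<and> (\<forall>c. y \<in> hump (w @ v @ fork c) ` {0..2/3})"
    if w: "balance w = 0" "y \<in> hump w ` {0..2/3}" for w
  proof -
    obtain v s where v: "balance v = 0" "s \<in> {1/2<..<13/24}" "y = hump (w @ v) s"
      using good[OF w(1)] w(2) by (auto simp: bad_def)
    have "y \<in> hump (w @ v @ fork c) ` {0..2/3}" for c
    proof -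
      \<comment> \<open>The inverse of the fork's affine map. The result is below 2/3 since 16 *
        (13/24 - 1/2) = 2/3.\<close>
      have "s = hump (fork c) ((if c then 4 else 16) * (s - 1/2))"
        by (auto simp: hump_0_1 hump_0_0_1_1 field_simps)
      hence "y = hump (w @ v @ fork c) ((if c then 4 else 16) * (s - 1/2))"
        using v hump_append[of "w @ v" "fork c"] w(1) by (simp add: balance_append)
      thus ?thesis using v(2) by (intro image_eqI) auto
    qed
    with v(1) show ?thesis by blast
  qed
  then obtain V where V: "\<And>w. balance w = 0 \<Longrightarrow> y \<in> hump w ` {0..2/3} \<Longrightarrow>
      balance (V w) = 0 \<and> (\<forall>c. y \<in> hump (w @ V w @ fork c) ` {0..2/3})" by metis
  have B: "balance (branch V b n) = 0 \<and> y \<in> hump (branch V b n) ` {0..2/3}" for b n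
  proof (induction n)
    case 0 show ?case using y by (auto simp: hump_def takagi_0)
  next
    case (Suc n) thus ?case using V[of "branch V b n"] by (auto simp: balance_append)
  qed
  have "\<exists>x. \<forall>n. \<exists>t. 0 \<le> t \<and> t < 1 \<and> x = pt (branch V b n) t" for b
    using branch_point by metis
  then obtain X where X: "\<And>b n. \<exists>t. 0 \<le> t \<and> t < 1 \<and> X b = pt (branch V b n) t" by metis
  have X01: "X b \<in> {0..<1}" for b using X[of b 0] by auto
  have TX: "takagi (X b) = y" for b
  proof -
    \<comment> \<open>Both values lie in the range of the hump at level \<open>n\<close>, whose
      height is below \<open>1 / 2 ^ n\<close>.\<close>
    have "\<bar>takagi (X b) - y\<bar> \<le> 1 / 2 ^ n" for n
    proof -
      let ?w = "branch V b n"
      obtain t where t: "0 \<le> t" "t < 1" "X b = pt ?w t" using X by blast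
      obtain s where s: "s \<in> {0..2/3}" "y = hump ?w s" using B by blast
      have "\<bar>takagi (X b) - y\<bar> = \<bar>takagi t - s\<bar> / 2 ^ length ?w"
        using hump_takagi[of ?w t] B t s(2) dist_hump[of ?w "takagi t" s] by simp
      also have "\<dots> \<le> 1 / 2 ^ n"
      proof (rule frac_le)
        show "\<bar>takagi t - s\<bar> \<le> 1" using s(1) takagi_nonneg[of t] takagi_le[of t] by auto
        show "(2::real) ^ n \<le> 2 ^ length ?w" using length_branch by (intro power_increasing) auto
      qed auto
      finally show ?thesis .
    qed
    moreover have "(\<lambda>n. 1 / 2 ^ n :: real) \<longlonglongrightarrow> 0" by real_asymp
    ultimately have "\<bar>takagi (X b) - y\<bar> \<le> 0" by (intro LIMSEQ_le_const) blast+
    thus ?thesis by simp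
  qed
  have "inj (\<lambda>b. local_level_set (X b))"
  proof (rule injI, rule ccontr)
    fix b b' assume eq: "local_level_set (X b) = local_level_set (X b')" and "b \<noteq> b'"
    have "X b \<in> local_level_set (X b)" using X01 by (simp add: local_level_set_def loc_equiv_def)
    hence "loc_equiv (X b) (X b')" unfolding eq by (simp add: local_level_set_def)
    moreover have "balance (branch V b n @ V (branch V b n)) = 0" for b n
      using V B by (simp add: balance_append)
    ultimately show False using branch_not_loc_equiv[OF _ X X \<open>b \<noteq> b'\<close>] by blast
  qed
  hence "uncountable (range (\<lambda>b. local_level_set (X b)))"
    using uncountable_nat_bool countable_image_inj_on by blast
  moreover have "range (\<lambda>b. local_level_set (X b)) \<subseteq>
      {A. A \<subseteq> level_set y \<and> (\<exists>x\<in>{0..<1}. A = local_level_set x)}"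
    using X01 TX loc_equiv_imp_takagi_eq by (fastforce simp: local_level_set_def level_set_def)
  ultimately show ?thesis unfolding S_inf_loc_uc_def using countable_subset by blast
qed

text \<open>A single local level set inside L(y) suffices, as it contains its own
  representative.\<close>

lemma S_inf_loc_uc_subset: "S_inf_loc_uc \<subseteq> {0..2/3}"
proof
  fix y assume y: "y \<in> S_inf_loc_uc"
  define F where "F = {A. A \<subseteq> level_set y \<and> (\<exists>x\<in>{0..<1}. A = local_level_set x)}"
  have "uncountable F" using y by (simp add: S_inf_loc_uc_def F_def)
  hence "F \<noteq> {}" by auto
  then obtain x where x: "x \<in> {0..<1}" "local_level_set x \<subseteq> level_set y"
    unfolding F_def by blast
  hence "x \<in> level_set y" by (auto simp: local_level_set_def loc_equiv_def)
  thus "y \<in> {0..2/3}" using takagi_nonneg takagi_le by (auto simp: level_set_def)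
qed

theorem theorem8:
  shows "takagi ` {0..1} = {0..2/3} \<and>
         residual_in (top_of_set {0..2/3}) S_inf_loc_uc"
proof
  let ?C = "{0..2/3} - S_inf_loc_uc"
  \<comment> \<open>Cutting with \<open>?C\<close> makes the union exactly the complement, as
    \<open>meager_in\<close> demands; there are only countably many words.\<close>
  let ?B = "(\<lambda>w. bad w \<inter> ?C) ` {w. balance w = 0}"
  have "\<exists>w. balance w = 0 \<and> y \<in> bad w" if "y \<in> ?C" for y
    using uncountably_many_local_level_sets[of y] that by auto
  hence "?C = \<Union> ?B" by auto
  moreover have "countable ?B" by (intro countable_image) auto
  moreover have "\<forall>A\<in>?B. nowhere_dense_in (top_of_set {0..2/3}) A"
    using nowhere_dense_bad by simp
  ultimately have "meager_in (top_of_set {0..2/3}) ?C" unfolding meager_in_def by blast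
  thus "residual_in (top_of_set {0..2/3}) S_inf_loc_uc"
    unfolding residual_in_def using S_inf_loc_uc_subset by simp
qed (rule takagi_image)

end
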